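(* Let $r \in \mathbb{N}\setminus \{1\}$. Then \[\left \lceil \frac{2^r - 1}{3} \right \rceil \le \mathsf{D}_0(C_2^r)\le \left \lceil \frac{2^r - 1}{3}\right \rceil + 2^{r/2}.\]
   Context: $C_2^r$ is the elementary abelian $2$-group of rank $r$. A sequence over a finite abelian group $G$ is a finite unordered list of elements with repetitions; zero-sum means its terms sum to $0$. $\mathsf{D}_k(G)$ ($k\in\mathbb{N}$) is the smallest $\ell$ such that every sequence over $G$ of length at least $\ell$ has $k$ disjoint non-empty zero-sum subsequences. $\mathsf{D}_0(G)\in\mathbb{N}_0$ denotes the (known to exist) integer such that $\mathsf{D}_k(G)=\mathsf{D}_0(G)+k\exp(G)$ for all sufficiently large $k$. *)

theory Defs
  imports "HOL-Analysis.Analysis" "HOL-Library.Z2"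
begin

instance bit :: finite
proof
  have "(UNIV::bit set) = range Abs_bit"
    by (metis Abs_bit_cases surj_def)
  then show "finite (UNIV::bit set)" by (metis finite finite_imageI)
qed

definition group_exp :: "('a::{ab_group_add,finite}) itself \<Rightarrow> nat" where
  "group_exp _ = (LEAST n. n > 0 \<and> (\<forall>x::'a. (\<Sum>i<n. x) = 0))"

definition has_disj_zs :: "nat \<Rightarrow> ('a::ab_group_add) list \<Rightarrow> bool" where
  "has_disj_zs k xs \<longleftrightarrow> (\<exists>I :: nat \<Rightarrow> nat set.
     (\<forall>j<k. I j \<noteq> {} \<and> I j \<subseteq> {..<length xs} \<and> (\<Sum>i\<in>I j. xs ! i) = 0) \<and>
     (\<forall>j<k. \<forall>j'<k. j \<noteq> j' \<longrightarrow> I j \<inter> I j' = {}))"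

definition Dk :: "('a::{ab_group_add,finite}) itself \<Rightarrow> nat \<Rightarrow> nat" where
  "Dk G k = (LEAST l. \<forall>xs::'a list. length xs \<ge> l \<longrightarrow> has_disj_zs k xs)"

definition D0 :: "('a::{ab_group_add,finite}) itself \<Rightarrow> nat" where
  "D0 G = (THE d. \<exists>K. \<forall>k\<ge>K. Dk G k = d + k * group_exp G)"

end

theory Submission
  imports Defs
begin

text \<open>
  Let \<open>N = 2 ^ r\<close> and let \<open>M S\<close> be the maximal number of disjoint zero-sum blocks in a
  sequence \<open>S\<close> over \<open>G = C\<^sub>2\<^sup>r\<close>. A zero, or a pair \<open>g g\<close> with \<open>g \<noteq> 0\<close>, contributes exactly one
  block (blocks using the two copies of \<open>g\<close> separately can be merged), so only subsets \<open>A\<close> of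
  \<open>G - {0}\<close> matter and \<open>D\<^sub>0 = max\<^sub>A (|A| - 2 M A) - 1\<close>.

  For the lower bound take \<open>A = G - {0, g}\<close>: every block has at least three elements, and the
  blocks cannot exhaust \<open>A\<close> because the elements of \<open>A\<close> sum to \<open>g \<noteq> 0\<close>.

  For the upper bound, fix a family of disjoint zero-sum triples covering all but at most eight
  elements of \<open>G\<close> and move it by a random automorphism. Automorphisms act transitively on pairs of
  distinct non-zero elements and \<open>A\<close> contains at least \<open>a (2 a - N)\<close> ordered pairs whose sum is
  again in \<open>A\<close> (\<open>a = |A|\<close>), so some image has \<open>t \<ge> (N - 8) / 3 * a (2 a - N) / ((N - 1) (N - 2))\<close>
  triples inside \<open>A\<close>. The rest of \<open>A\<close> is cut greedily into blocks of at most four elements until a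
  Sidon set of size \<open>s = O(sqrt N)\<close> is left. Hence \<open>|A| - 2 M A \<le> (a - t + s) / 2\<close>, and the main
  term is largest for \<open>a = N - 1\<close>, where it equals \<open>(N - 1) / 3\<close>.
\<close>

section \<open>Packings by zero-sum blocks\<close>

text \<open>Blocks are index sets weighted by \<open>v\<close>, so one notion serves sequences
  (\<open>v = (!) xs\<close> on positions) and subsets of the group (\<open>v\<close> the
  identity).\<close>

definition zs_packing :: "('i \<Rightarrow> 'a::comm_monoid_add) \<Rightarrow> 'i set \<Rightarrow> nat \<Rightarrow> bool" where
  "zs_packing v J k \<longleftrightarrow> (\<exists>C. finite C \<and> card C = k \<and> disjoint C \<and>
     (\<forall>B\<in>C. B \<noteq> {} \<and> B \<subseteq> J \<and> sum v B = 0))"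

lemma zs_packing_0: "zs_packing v J 0"
  unfolding zs_packing_def by (rule exI[of _ "{}"]) auto

lemma zs_packing_antimono:
  assumes "zs_packing v J k" "k' \<le> k"
  shows "zs_packing v J k'"
proof -
  obtain C where C: "finite C" "card C = k" "disjoint C"
    "\<forall>B\<in>C. B \<noteq> {} \<and> B \<subseteq> J \<and> sum v B = 0"
    using assms(1) unfolding zs_packing_def by blast
  obtain C' where "C' \<subseteq> C" "card C' = k'"
    using assms(2) C(2) by (metis obtain_subset_with_card_n)
  then show ?thesis
    unfolding zs_packing_def using C
    by (intro exI[of _ C']) (auto intro: finite_subset pairwise_subset)
qed

lemma zs_packing_Un:
  assumes "zs_packing v J k" "zs_packing v J' k'" "J \<inter> J' = {}"
  shows "zs_packing v (J \<union> J') (k + k')"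
proof -
  obtain C where C: "finite C" "card C = k" "disjoint C"
    "\<forall>B\<in>C. B \<noteq> {} \<and> B \<subseteq> J \<and> sum v B = 0"
    using assms(1) unfolding zs_packing_def by blast
  obtain C' where C': "finite C'" "card C' = k'" "disjoint C'"
    "\<forall>B\<in>C'. B \<noteq> {} \<and> B \<subseteq> J' \<and> sum v B = 0"
    using assms(2) unfolding zs_packing_def by blast
  have cross: "B \<inter> B' = {}" if "B \<in> C" "B' \<in> C'" for B B'
  proof -
    have "B \<subseteq> J" "B' \<subseteq> J'"
      using that C(4) C'(4) by auto
    then show ?thesis
      using assms(3) by blast
  qed
  then have "C \<inter> C' = {}"
    using C(4) by (metis disjoint_iff inf.idem)
  moreover have "disjoint (C \<union> C')"
    using C(3) C'(3) cross unfolding disjoint_def by blast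
  ultimately show ?thesis
    unfolding zs_packing_def using C C'
    by (intro exI[of _ "C \<union> C'"]) (auto simp: card_Un_disjoint)
qed

lemma zs_packing_single: "B \<noteq> {} \<Longrightarrow> sum v B = 0 \<Longrightarrow> zs_packing v B 1"
  unfolding zs_packing_def by (rule exI[of _ "{B}"]) auto

lemma zs_packing_insert_block:
  assumes "zs_packing v (J - B) k" "B \<noteq> {}" "B \<subseteq> J" "sum v B = 0"
  shows "zs_packing v J (Suc k)"
proof -
  have "zs_packing v (B \<union> (J - B)) (1 + k)"
    using zs_packing_Un[OF zs_packing_single[OF assms(2,4)] assms(1)] by blast
  moreover have "B \<union> (J - B) = J"
    using assms(3) by blast
  ultimately show ?thesis by simp
qed

lemma zs_packing_bij:
  assumes "bij_betw h J J'" "\<And>i. i \<in> J \<Longrightarrow> w (h i) = v i" "zs_packing v J k"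
  shows "zs_packing w J' k"
proof -
  obtain C where C: "finite C" "card C = k" "disjoint C"
    "\<forall>B\<in>C. B \<noteq> {} \<and> B \<subseteq> J \<and> sum v B = 0"
    using assms(3) unfolding zs_packing_def by blast
  have inj: "inj_on h J" and img: "h ` J = J'"
    using assms(1) by (auto simp: bij_betw_def)
  have injC: "inj_on ((`) h) C"
    using C(4) inj by (meson inj_onI inj_on_image_eq_iff)
  have "disjoint ((`) h ` C)"
    unfolding disjoint_def
  proof (intro ballI impI)
    fix X Y assume "X \<in> (`) h ` C" "Y \<in> (`) h ` C" "X \<noteq> Y"
    then obtain B B' where B: "B \<in> C" "B' \<in> C" "X = h ` B" "Y = h ` B'" "B \<noteq> B'"
      by blast
    then have "B \<inter> B' = {}"
      using C(3) unfolding disjoint_def by blast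
    moreover have "h ` B \<inter> h ` B' = h ` (B \<inter> B')"
      using B C(4) inj by (metis inj_on_image_Int)
    ultimately show "X \<inter> Y = {}"
      using B by simp
  qed
  moreover have "sum w (h ` B) = 0" if "B \<in> C" for B
  proof -
    have "B \<subseteq> J" "sum v B = 0"
      using that C(4) by auto
    then have "sum w (h ` B) = sum (w \<circ> h) B"
      using inj by (intro sum.reindex) (rule inj_on_subset)
    moreover have "sum (w \<circ> h) B = sum v B"
      using \<open>B \<subseteq> J\<close> assms(2) by (intro sum.cong) auto
    ultimately show ?thesis
      using \<open>sum v B = 0\<close> by simp
  qed
  ultimately show ?thesis
    unfolding zs_packing_def using C injC img
    by (intro exI[of _ "(`) h ` C"]) (auto simp: card_image)
qed

lemma zs_packing_image_iff:
  assumes "inj_on v J"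
  shows "zs_packing (\<lambda>x. x) (v ` J) k \<longleftrightarrow> zs_packing v J k"
proof
  assume "zs_packing (\<lambda>x. x) (v ` J) k"
  then show "zs_packing v J k"
    using assms by (intro zs_packing_bij[of "the_inv_into J v" "v ` J"])
      (auto simp: bij_betw_def inj_on_the_inv_into the_inv_into_f_f)
next
  assume "zs_packing v J k"
  then show "zs_packing (\<lambda>x. x) (v ` J) k"
    using assms by (intro zs_packing_bij[of v J]) (auto simp: bij_betw_def)
qed

lemma has_disj_zs_iff_zs_packing:
  "has_disj_zs k xs \<longleftrightarrow> zs_packing ((!) xs) {..<length xs} k"
proof
  assume "has_disj_zs k xs"
  then obtain I where I: "\<And>j. j < k \<Longrightarrow> I j \<noteq> {} \<and> I j \<subseteq> {..<length xs} \<and> (\<Sum>i\<in>I j. xs ! i) = 0"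
    "\<And>j j'. j < k \<Longrightarrow> j' < k \<Longrightarrow> j \<noteq> j' \<Longrightarrow> I j \<inter> I j' = {}"
    unfolding has_disj_zs_def by metis
  have "inj_on I {..<k}"
  proof (rule inj_onI)
    fix j j' assume "j \<in> {..<k}" "j' \<in> {..<k}" "I j = I j'"
    then show "j = j'"
      using I(1)[of j] I(2)[of j j'] by auto
  qed
  then have "card (I ` {..<k}) = k"
    by (simp add: card_image)
  moreover have "disjoint (I ` {..<k})"
    unfolding disjoint_def
  proof (intro ballI impI)
    fix X Y assume "X \<in> I ` {..<k}" "Y \<in> I ` {..<k}" "X \<noteq> Y"
    then obtain j j' where "j < k" "j' < k" "X = I j" "Y = I j'" "j \<noteq> j'"
      by auto
    then show "X \<inter> Y = {}"
      using I(2) by simp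
  qed
  moreover have "\<forall>B\<in>I ` {..<k}. B \<noteq> {} \<and> B \<subseteq> {..<length xs} \<and> sum ((!) xs) B = 0"
    using I(1) by blast
  ultimately show "zs_packing ((!) xs) {..<length xs} k"
    unfolding zs_packing_def by (intro exI[of _ "I ` {..<k}"]) simp
next
  assume "zs_packing ((!) xs) {..<length xs} k"
  then obtain C where C: "finite C" "card C = k" "disjoint C"
    "\<forall>B\<in>C. B \<noteq> {} \<and> B \<subseteq> {..<length xs} \<and> sum ((!) xs) B = 0"
    unfolding zs_packing_def by blast
  obtain I where I: "bij_betw I {..<k} C"
    using C(1,2) by (metis ex_bij_betw_nat_finite atLeast0LessThan)
  have mem: "I j \<in> C" if "j < k" for j
    using I that by (auto simp: bij_betw_def)
  have "I j \<inter> I j' = {}" if "j < k" "j' < k" "j \<noteq> j'" for j j'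
  proof -
    have "I j \<noteq> I j'"
      using I that by (auto simp: bij_betw_def inj_on_def)
    then show ?thesis
      using C(3) mem that unfolding disjoint_def by blast
  qed
  then show "has_disj_zs k xs"
    unfolding has_disj_zs_def using mem C(4)
    by (intro exI[of _ I]) auto
qed

text \<open>If \<open>i\<close> and \<open>j\<close> lie in different blocks, the union of these blocks without \<open>i\<close> and \<open>j\<close> is
  again a block: it is non-empty because \<open>v i \<noteq> 0\<close>.\<close>

lemma zs_packing_remove_pair:
  fixes v :: "'i \<Rightarrow> 'a::ab_group_add"
  assumes "zs_packing v J (Suc k)" "finite J" "i \<in> J" "j \<in> J" "i \<noteq> j"
    and "v i + v j = 0" "v i \<noteq> 0"
  shows "zs_packing v (J - {i, j}) k"
proof -
  obtain C where C: "finite C" "card C = Suc k" "disjoint C"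
    "\<forall>B\<in>C. B \<noteq> {} \<and> B \<subseteq> J \<and> sum v B = 0"
    using assms(1) unfolding zs_packing_def by blast
  have dis: "B \<inter> B' = {}" if "B \<in> C" "B' \<in> C" "B \<noteq> B'" for B B'
    using C(3) that unfolding disjoint_def by blast
  \<comment> \<open>If at most one block \<open>B0\<close> meets the pair, discarding it leaves at
    least \<open>k\<close> of the \<open>Suc k\<close> blocks.\<close>
  have remove_one: "zs_packing v (J - {i, j}) k"
    if "\<And>B. B \<in> C \<Longrightarrow> B \<noteq> B0 \<Longrightarrow> B \<inter> {i, j} = {}" for B0
  proof -
    have "zs_packing v (J - {i, j}) (card (C - {B0}))"
      unfolding zs_packing_def using C that
      by (intro exI[of _ "C - {B0}"]) (auto intro: pairwise_subset)
    moreover have "k \<le> card (C - {B0})"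
      using C(1,2) by (simp add: card_Diff_singleton_if)
    ultimately show ?thesis
      by (rule zs_packing_antimono)
  qed
  show ?thesis
  proof (cases "\<exists>B\<in>C. \<exists>B'\<in>C. i \<in> B \<and> j \<in> B' \<and> B \<noteq> B'")
    case False
    show ?thesis
    proof (cases "\<exists>B\<in>C. i \<in> B \<or> j \<in> B")
      case True
      then obtain B0 where B0: "B0 \<in> C" "i \<in> B0 \<or> j \<in> B0" by blast
      show ?thesis
      proof (rule remove_one[of B0])
        fix B assume B: "B \<in> C" "B \<noteq> B0"
        then have "B \<inter> B0 = {}" using dis B0 by blast
        with B B0 False show "B \<inter> {i, j} = {}" by auto
      qed
    next
      case F: False
      \<comment> \<open>No block meets the pair. The empty set is never a block, so as a dummy it
        discards nothing.\<close>
      show ?thesis by (rule remove_one[of "{}"]) (use F in blast)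
    qed
  next
    case True
    then obtain B B' where B: "B \<in> C" "B' \<in> C" "i \<in> B" "j \<in> B'" "B \<noteq> B'" by blast
    define E where "E = (B \<union> B') - {i, j}"
    have disj: "B \<inter> B' = {}" using dis B by blast
    have fin: "finite B" "finite B'"
      using B C(4) assms(2) by (meson finite_subset)+
    have E_alt: "E = (B - {i}) \<union> (B' - {j})"
      using disj B by (auto simp: E_def)
    have "sum v E = sum v (B - {i}) + sum v (B' - {j})"
      unfolding E_alt using fin disj by (intro sum.union_disjoint) auto
    also have "\<dots> = (sum v B - v i) + (sum v B' - v j)"
      using fin B by (simp add: sum_diff1)
    also have "\<dots> = - (v i + v j)"
      using C(4) B by (simp add: algebra_simps)
    finally have sumE: "sum v E = 0" using assms(6) by simp
    have "B \<noteq> {i}"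
      using C(4) B(1) assms(7) by auto
    then have Ene: "E \<noteq> {}"
      using B disj unfolding E_alt by blast
    have ECd: "B'' \<inter> E = {}" "B'' \<inter> {i, j} = {}" if "B'' \<in> C - {B, B'}" for B''
      using that dis[of B'' B] dis[of B'' B'] B unfolding E_def by blast+
    have Eni: "E \<notin> C - {B, B'}"
      using ECd(1)[of E] Ene by blast
    have dj: "disjoint (insert E (C - {B, B'}))"
      unfolding disjoint_def
    proof (intro ballI impI)
      fix X Y assume XY: "X \<in> insert E (C - {B, B'})" "Y \<in> insert E (C - {B, B'})" "X \<noteq> Y"
      show "X \<inter> Y = {}"
        using XY ECd(1) dis by (metis Diff_iff Int_commute insert_iff)
    qed
    have "card (insert E (C - {B, B'})) = k"
    proof -
      have "card {B, B'} \<le> card C"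
        using B C(1) by (intro card_mono) auto
      moreover have "card {B, B'} = 2"
        using B(5) by simp
      ultimately show ?thesis
        using Eni C(1,2) B by (simp add: card_Diff_subset)
    qed
    moreover have "\<forall>X\<in>insert E (C - {B, B'}). X \<noteq> {} \<and> X \<subseteq> J - {i, j} \<and> sum v X = 0"
    proof
      fix X assume "X \<in> insert E (C - {B, B'})"
      then consider "X = E" | "X \<in> C - {B, B'}" by blast
      then show "X \<noteq> {} \<and> X \<subseteq> J - {i, j} \<and> sum v X = 0"
      proof cases
        case 1
        then show ?thesis using Ene sumE B C(4) unfolding E_def by blast
      next
        case 2
        then show ?thesis using ECd(2)[OF 2] C(4) by blast
      qed
    qed
    ultimately show ?thesis
      unfolding zs_packing_def using C(1) dj
      by (intro exI[of _ "insert E (C - {B, B'})"]) auto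
  qed
qed

section \<open>Reduction from sequences to sets of non-zero elements\<close>

text \<open>A zero, or two indices of equal value, form a block. Splitting it off gains one block
  and loses at most two indices, so a bound \<open>d\<close> on \<open>card J - 2 * k\<close>
  survives. Once this stops, \<open>v\<close> is injective and non-zero on \<open>J\<close>.\<close>

lemma zs_packing_reduce_to_sets:
  fixes v :: "'i \<Rightarrow> 'a::ab_group_add"
  assumes two: "\<And>x::'a. x + x = 0"
    and sets: "\<And>A::'a set. finite A \<Longrightarrow> 0 \<notin> A \<Longrightarrow>
      \<exists>k. zs_packing (\<lambda>x. x) A k \<and> int (card A) \<le> 2 * int k + d"
    and "finite J"
  shows "\<exists>k. zs_packing v J k \<and> int (card J) \<le> 2 * int k + d"
  using \<open>finite J\<close>
proof (induction "card J" arbitrary: J rule: less_induct)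
  case less
  have step: ?case if B: "B \<subseteq> J" "B \<noteq> {}" "card B \<le> 2" "sum v B = 0" for B
  proof -
    have fB: "finite B" using B less.prems by (meson finite_subset)
    have "card (J - B) < card J"
      using B less.prems by (intro psubset_card_mono) auto
    then obtain k where k: "zs_packing v (J - B) k" "int (card (J - B)) \<le> 2 * int k + d"
      using less by (metis finite_Diff)
    have "card (J - B) = card J - card B" "card B \<le> card J"
      using B fB less.prems by (auto simp: card_Diff_subset card_mono)
    then have "card J \<le> card (J - B) + 2"
      using B(3) by linarith
    then have "int (card J) \<le> 2 * int (Suc k) + d"
      using k(2) by simp
    then show ?thesis
      using zs_packing_insert_block[OF k(1)] B by blast
  qed
  show ?case
  proof (cases "inj_on v J \<and> 0 \<notin> v ` J")
    case True
    then show ?thesis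
      using sets[of "v ` J"] less.prems by (auto simp: zs_packing_image_iff card_image)
  next
    case False
    then consider i where "i \<in> J" "v i = 0" | i j where "i \<in> J" "j \<in> J" "i \<noteq> j" "v i = v j"
      by (auto simp: inj_on_def)
    then show ?thesis
    proof cases
      case 1
      then show ?thesis by (intro step[of "{i}"]) auto
    next
      case 2
      then show ?thesis by (intro step[of "{i, j}"]) (auto simp: two)
    qed
  qed
qed

text \<open>The values \<open>|A| - 2 k\<close> with \<open>k \<ge> M A\<close>; their maximum is \<open>max\<^sub>A (|A| - 2 M A)\<close>.\<close>

definition set_defect :: "'a::{ab_group_add,finite} itself \<Rightarrow> int \<Rightarrow> bool" where
  "set_defect _ d \<longleftrightarrow> (\<exists>(A::'a set) k. 0 \<notin> A \<and> \<not> zs_packing (\<lambda>x. x) A (Suc k) \<and>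
     d = int (card A) - 2 * int k)"

lemma maximal_zs_packing:
  assumes "finite J"
  obtains k where "zs_packing v J k" "\<not> zs_packing v J (Suc k)"
proof -
  have "\<not> zs_packing v J (Suc (card (Pow J)))"
  proof
    assume "zs_packing v J (Suc (card (Pow J)))"
    then obtain C where C: "card C = Suc (card (Pow J))" "\<forall>B\<in>C. B \<subseteq> J"
      unfolding zs_packing_def by blast
    then have "card C \<le> card (Pow J)"
      using assms by (intro card_mono) auto
    with C(1) show False by simp
  qed
  then obtain n where n: "\<not> zs_packing v J n" "\<forall>m<n. zs_packing v J m"
    using exists_least_iff[of "\<lambda>n. \<not> zs_packing v J n"] by blast
  then obtain m where "n = Suc m"
    using zs_packing_0[of v J] by (cases n) auto
  then show ?thesis
    using that n by blast
qed

text \<open>For large \<open>k\<close>, \<open>Dk\<close> equals \<open>2 * k + d - 1\<close>: the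
  reduction to sets gives the upper bound, and an extremal set padded with pairs \<open>g g\<close>
  has length \<open>2 * k + d - 2\<close> but no \<open>k\<close> disjoint blocks.\<close>

lemma D0_eq_max_defect:
  assumes two: "\<And>x::'a::{ab_group_add,finite}. x + x = 0"
    and g: "(g::'a) \<noteq> 0"
  obtains d where "set_defect TYPE('a) d" "\<And>d'. set_defect TYPE('a) d' \<Longrightarrow> d' \<le> d"
    "int (D0 TYPE('a)) = d - 1"
proof -
  have bound: "d \<le> int CARD('a)" if d: "set_defect TYPE('a) d" for d
  proof -
    obtain A :: "'a set" and k where "d = int (card A) - 2 * int k"
      using d unfolding set_defect_def by blast
    moreover have "card A \<le> CARD('a)" by (simp add: card_mono)
    ultimately show ?thesis by linarith
  qed
  \<comment> \<open>The singleton \<open>{g}\<close> has defect 1, hence \<open>d \<ge> 1\<close>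
    and \<open>nat (d - 1)\<close> truncates nothing.\<close>
  have "\<not> zs_packing (\<lambda>x. x) {g} (Suc 0)"
  proof
    assume "zs_packing (\<lambda>x. x) {g} (Suc 0)"
    then obtain C where C: "card C = Suc 0" "\<forall>B\<in>C. B \<noteq> {} \<and> B \<subseteq> {g} \<and> \<Sum>B = 0"
      unfolding zs_packing_def by blast
    then obtain B where "B \<in> C" by (metis card.empty ex_in_conv nat.distinct(1))
    then have "B = {g}" "\<Sum>B = 0" using C(2) by auto
    then show False using g by simp
  qed
  then have one: "set_defect TYPE('a) 1"
    unfolding set_defect_def using g by (intro exI[of _ "{g}"] exI[of _ 0]) auto
  define V where "V = {d. set_defect TYPE('a) d \<and> 1 \<le> d}"
  have finV: "finite V"
    by (rule finite_subset[of _ "{1..int CARD('a)}"]) (auto simp: V_def bound)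
  have "1 \<in> V" using one by (simp add: V_def)
  define d where "d = Max V"
  have dV: "d \<in> V" using finV \<open>1 \<in> V\<close> unfolding d_def by (intro Max_in) auto
  then have d: "set_defect TYPE('a) d" "d \<ge> 1" by (auto simp: V_def)
  have dmax: "d' \<le> d" if "set_defect TYPE('a) d'" for d'
  proof (cases "1 \<le> d'")
    case True
    then show ?thesis using that finV unfolding d_def by (intro Max_ge) (auto simp: V_def)
  next
    case False
    then show ?thesis using d(2) by linarith
  qed
  have sets: "\<exists>k. zs_packing (\<lambda>x. x) A k \<and> int (card A) \<le> 2 * int k + d"
    if A: "0 \<notin> A" for A :: "'a set"
  proof -
    obtain k where k: "zs_packing (\<lambda>x. x) A k" "\<not> zs_packing (\<lambda>x. x) A (Suc k)"
      by (rule maximal_zs_packing[of A "\<lambda>x. x"]) simp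
    then have "int (card A) - 2 * int k \<le> d"
      using A by (intro dmax) (auto simp: set_defect_def)
    then show ?thesis using k(1) by (intro exI[of _ k]) simp
  qed
  have upper: "has_disj_zs k xs" if len: "int (length xs) \<ge> 2 * int k + d - 1" for k and xs :: "'a list"
  proof -
    obtain k' where k': "zs_packing ((!) xs) {..<length xs} k'"
      "int (card {..<length xs}) \<le> 2 * int k' + d"
      using zs_packing_reduce_to_sets[of d "{..<length xs}" "(!) xs"] two sets by auto
    \<comment> \<open>The two bounds give \<open>2 * k - 1 \<le> 2 * k'\<close>, and parity recovers
      the missing 1.\<close>
    then have "k \<le> k'" using len by simp
    then show ?thesis
      using k'(1) zs_packing_antimono by (auto simp: has_disj_zs_iff_zs_packing)
  qed
  obtain A :: "'a set" and k0 where A: "0 \<notin> A" "\<not> zs_packing (\<lambda>x. x) A (Suc k0)"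
    "d = int (card A) - 2 * int k0"
    using d(1) unfolding set_defect_def by blast
  obtain ys where ys: "set ys = A" "distinct ys"
    using finite_distinct_list[of A] by auto
  have len_ys: "length ys = card A" using ys by (metis distinct_card)
  \<comment> \<open>The default value \<open>g\<close> beyond \<open>ys\<close> lets a single
    \<open>v\<close> describe the padded sequences of all lengths.\<close>
  define v where "v i = (if i < length ys then ys ! i else g)" for i
  have "v ` {..<length ys} = A" "inj_on v {..<length ys}"
    using ys by (auto simp: v_def inj_on_def nth_eq_iff_index_eq set_conv_nth)
  then have base: "\<not> zs_packing v {..<length ys} (Suc k0)"
    using A(2) zs_packing_image_iff by metis
  \<comment> \<open>By \<open>zs_packing_remove_pair\<close>, each pair \<open>g g\<close> raises
    the number of blocks by at most one.\<close>
  have npack: "\<not> zs_packing v {..<length ys + 2 * p} (Suc (k0 + p))" for p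
  proof (induction p)
    case 0
    then show ?case using base by simp
  next
    case (Suc p)
    define m where "m = length ys + 2 * p"
    have "{..<length ys + 2 * Suc p} - {m, Suc m} = {..<m}"
      by (auto simp: m_def)
    moreover have "v m = g" "v (Suc m) = g" by (auto simp: m_def v_def)
    ultimately show ?case
      using Suc zs_packing_remove_pair[of v "{..<length ys + 2 * Suc p}" "Suc (k0 + p)" m "Suc m"]
        two g by (auto simp: m_def)
  qed
  have lower: "\<exists>xs::'a list. int (length xs) = 2 * int k + d - 2 \<and> \<not> has_disj_zs k xs"
    if k: "k \<ge> Suc k0" for k
  proof -
    define p where "p = k - Suc k0"
    define xs where "xs = ys @ replicate (2 * p) g"
    have len: "length xs = length ys + 2 * p" by (simp add: xs_def)
    have kp: "Suc (k0 + p) = k" using k by (simp add: p_def)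
    have nth: "xs ! i = v i" if "i < length xs" for i
      using that by (auto simp: xs_def v_def nth_append)
    have "\<not> has_disj_zs k xs"
    proof
      assume "has_disj_zs k xs"
      then have "zs_packing v {..<length xs} k"
        unfolding has_disj_zs_iff_zs_packing using nth
        by (intro zs_packing_bij[of "\<lambda>i. i" "{..<length xs}" _ v "(!) xs"]) (auto simp: bij_betw_def)
      then show False using npack[of p] kp len by simp
    qed
    moreover have "int (length xs) = 2 * int k + d - 2"
      using len len_ys A(3) kp by auto
    ultimately show ?thesis by blast
  qed
  have Dk_eq: "Dk TYPE('a) k = nat (d - 1) + k * 2" if k: "k \<ge> Suc k0" for k
    unfolding Dk_def
  proof (rule Least_equality)
    show "\<forall>xs::'a list. nat (d - 1) + k * 2 \<le> length xs \<longrightarrow> has_disj_zs k xs"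
      using upper d(2) by auto
  next
    fix l assume l: "\<forall>xs::'a list. l \<le> length xs \<longrightarrow> has_disj_zs k xs"
    obtain xs :: "'a list" where "int (length xs) = 2 * int k + d - 2" "\<not> has_disj_zs k xs"
      using lower k by blast
    moreover from this have "length xs < l"
      using l by (meson not_le)
    ultimately show "nat (d - 1) + k * 2 \<le> l"
      using d(2) by linarith
  qed
  have exp2: "group_exp TYPE('a) = 2"
    unfolding group_exp_def
  proof (rule Least_equality)
    show "0 < (2::nat) \<and> (\<forall>x::'a. (\<Sum>i<(2::nat). x) = 0)"
      by (simp add: two numeral_2_eq_2)
  next
    fix n :: nat assume n: "0 < n \<and> (\<forall>x::'a. (\<Sum>i<n. x) = 0)"
    then have "n \<noteq> 1" using g by auto
    then show "2 \<le> n" using n by linarith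
  qed
  have "D0 TYPE('a) = nat (d - 1)"
    unfolding D0_def
  proof (rule the_equality)
    show "\<exists>K. \<forall>k\<ge>K. Dk TYPE('a) k = nat (d - 1) + k * group_exp TYPE('a)"
      using Dk_eq exp2 by auto
  next
    fix e assume "\<exists>K. \<forall>k\<ge>K. Dk TYPE('a) k = e + k * group_exp TYPE('a)"
    then obtain K where "\<forall>k\<ge>K. Dk TYPE('a) k = e + k * group_exp TYPE('a)" by blast
    then have "Dk TYPE('a) (max K (Suc k0)) = e + max K (Suc k0) * 2"
      using exp2 by simp
    then show "e = nat (d - 1)"
      using Dk_eq[of "max K (Suc k0)"] by simp
  qed
  then show ?thesis
    using that d dmax by simp
qed

section \<open>Short zero-sum sets and random triples\<close>

lemma add_eq_0_iff_eq_of_exponent_two: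
  fixes x y :: "'a::ab_group_add"
  assumes "\<And>x::'a. x + x = 0"
  shows "x + y = 0 \<longleftrightarrow> x = y"
  using assms by (metis add_left_cancel)

text \<open>Two distinct pairs with equal sums would have a zero-sum symmetric difference of at most
  four elements. So the pairs from \<open>S\<close> have distinct non-zero sums: \<open>S\<close> is
  a Sidon set.\<close>

lemma card_no_short_zero_sum:
  fixes S :: "'a::{ab_group_add,finite} set"
  assumes two: "\<And>x::'a. x + x = 0"
    and short: "\<And>B. B \<subseteq> S \<Longrightarrow> B \<noteq> {} \<Longrightarrow> card B \<le> 4 \<Longrightarrow> \<Sum>B \<noteq> 0"
  shows "card S * (card S - 1) \<le> 2 * (CARD('a) - 1)"
proof -
  define P where "P = {B. B \<subseteq> S \<and> card B = 2}"
  have finB: "finite B" for B :: "'a set" by simp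
  have inj: "inj_on Sum P"
  proof (rule inj_onI, rule ccontr)
    fix B B' assume B: "B \<in> P" "B' \<in> P" "\<Sum>B = \<Sum>B'" "B \<noteq> B'"
    define E where "E = (B - B') \<union> (B' - B)"
    have "\<Sum>B = \<Sum>(B - B') + \<Sum>(B \<inter> B')" "\<Sum>B' = \<Sum>(B' - B) + \<Sum>(B \<inter> B')"
      by (metis add.commute finB sum.Int_Diff) (metis add.commute finB inf_commute sum.Int_Diff)
    then have "\<Sum>(B - B') = \<Sum>(B' - B)"
      using B(3) by simp
    moreover have "\<Sum>E = \<Sum>(B - B') + \<Sum>(B' - B)"
      unfolding E_def by (intro sum.union_disjoint) auto
    ultimately have "\<Sum>E = 0"
      using two by simp
    moreover have "E \<subseteq> S" "E \<noteq> {}"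
      using B by (auto simp: E_def P_def)
    moreover have "card E \<le> card (B \<union> B')"
      by (intro card_mono) (auto simp: E_def)
    then have "card E \<le> 4"
      using card_Un_le[of B B'] B by (simp add: P_def)
    ultimately show False
      using short by blast
  qed
  have "Sum ` P \<subseteq> UNIV - {0::'a}"
  proof
    fix y assume "y \<in> Sum ` P"
    then obtain B where "B \<subseteq> S" "card B = 2" "y = \<Sum>B"
      by (auto simp: P_def)
    then show "y \<in> UNIV - {0}"
      using short[of B] by fastforce
  qed
  then have "card (Sum ` P) \<le> card (UNIV - {0::'a})"
    by (intro card_mono) auto
  then have "card P \<le> CARD('a) - 1"
    using inj by (simp add: card_image card_Diff_singleton)
  moreover have "card P = card S choose 2"
    unfolding P_def by (rule n_subsets) simp
  moreover have "2 * (card S choose 2) = card S * (card S - 1)"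
    unfolding choose_two by (cases "card S") auto
  ultimately show ?thesis
    by linarith
qed

text \<open>Remove blocks of at most four elements while there are any; \<open>s\<close> is the size
  of the Sidon set that is left.\<close>

lemma greedy_zs_packing:
  fixes A :: "'a::{ab_group_add,finite} set"
  assumes two: "\<And>x::'a. x + x = 0"
  shows "\<exists>k s. zs_packing (\<lambda>x. x) A k \<and> card A \<le> 4 * k + s \<and> s * (s - 1) \<le> 2 * (CARD('a) - 1)"
proof (induction "card A" arbitrary: A rule: less_induct)
  case less
  show ?case
  proof (cases "\<exists>B\<subseteq>A. B \<noteq> {} \<and> card B \<le> 4 \<and> \<Sum>B = 0")
    case True
    then obtain B where B: "B \<subseteq> A" "B \<noteq> {}" "card B \<le> 4" "\<Sum>B = 0" by blast
    have "card (A - B) < card A"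
      using B by (intro psubset_card_mono) auto
    then obtain k s where k: "zs_packing (\<lambda>x. x) (A - B) k" "card (A - B) \<le> 4 * k + s"
      "s * (s - 1) \<le> 2 * (CARD('a) - 1)"
      using less by blast
    have "zs_packing (\<lambda>x. x) A (Suc k)"
      using zs_packing_insert_block[OF k(1) B(2,1,4)] .
    moreover have "card A \<le> 4 * Suc k + s"
      using B k(2) by (simp add: card_Diff_subset)
    ultimately show ?thesis
      using k(3) by blast
  next
    case False
    then have "card A * (card A - 1) \<le> 2 * (CARD('a) - 1)"
      by (intro card_no_short_zero_sum two) blast
    then show ?thesis
      by (intro exI[of _ 0] exI[of _ "card A"]) (simp add: zs_packing_0)
  qed
qed

section \<open>Zero-sum triples in a set and averaging over automorphisms\<close>

text \<open>For \<open>x \<in> A\<close>, both \<open>A - {x}\<close> and its translate by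
  \<open>x\<close> avoid \<open>0\<close> and \<open>x\<close>. With \<open>a = card A\<close> and
  \<open>N = CARD('a)\<close> they therefore share at least \<open>2 * (a - 1) - (N - 2)\<close>
  elements. Integers allow this to be negative.\<close>

lemma card_triples_in_set:
  fixes A :: "'a::{ab_group_add,finite} set"
  assumes two: "\<And>x::'a. x + x = 0" and "0 \<notin> A"
  shows "int (card A) * (2 * int (card A) - int CARD('a))
    \<le> int (card {(x, y). x \<in> A \<and> y \<in> A \<and> x \<noteq> y \<and> x + y \<in> A})"
proof -
  note add0 = add_eq_0_iff_eq_of_exponent_two[OF two]
  have cancel: "x + (x + y) = y" for x y :: 'a
    by (metis add.assoc add.left_neutral two)
  have fibre: "2 * int (card A) - int CARD('a) \<le> int (card {y \<in> A. x \<noteq> y \<and> x + y \<in> A})"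
    if x: "x \<in> A" for x
  proof -
    define B where "B = A - {x}"
    define B' where "B' = (+) x ` B"
    have xne: "x \<noteq> 0" using x assms(2) by blast
    have cardB: "card B = card A - 1" "card A \<ge> 1"
      using x by (auto simp: B_def card_Diff_singleton Suc_le_eq card_gt_0_iff)
    have cardB': "card B' = card B"
      unfolding B'_def by (intro card_image) simp
    have "B \<union> B' \<subseteq> UNIV - {0, x}"
      using assms(2) x by (auto simp: B_def B'_def add0)
    then have "card (B \<union> B') \<le> card (UNIV - {0, x})"
      by (intro card_mono) auto
    also have "\<dots> = CARD('a) - 2"
      using xne by (simp add: card_Diff_subset)
    finally have "card (B \<union> B') \<le> CARD('a) - 2" .
    moreover have "card {0, x} \<le> CARD('a)"
      by (intro card_mono) auto
    then have "CARD('a) \<ge> 2"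
      using xne by simp
    moreover have "card (B \<union> B') + card (B \<inter> B') = card B + card B'"
      by (metis card_Un_Int finite)
    moreover have "B \<inter> B' \<subseteq> {y \<in> A. x \<noteq> y \<and> x + y \<in> A}"
      by (auto simp: B_def B'_def cancel)
    then have "card (B \<inter> B') \<le> card {y \<in> A. x \<noteq> y \<and> x + y \<in> A}"
      by (intro card_mono) auto
    ultimately show ?thesis
      using cardB cardB' by linarith
  qed
  have "{(x, y). x \<in> A \<and> y \<in> A \<and> x \<noteq> y \<and> x + y \<in> A} =
      (SIGMA x:A. {y \<in> A. x \<noteq> y \<and> x + y \<in> A})"
    by auto
  then have "int (card {(x, y). x \<in> A \<and> y \<in> A \<and> x \<noteq> y \<and> x + y \<in> A}) =
      (\<Sum>x\<in>A. int (card {y \<in> A. x \<noteq> y \<and> x + y \<in> A}))"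
    by simp
  also have "\<dots> \<ge> (\<Sum>x\<in>A. 2 * int (card A) - int CARD('a))"
    by (intro sum_mono fibre)
  finally show ?thesis by simp
qed

definition additive_bijections :: "('a::ab_group_add \<Rightarrow> 'a) set" where
  "additive_bijections = {f. bij f \<and> (\<forall>x y. f (x + y) = f x + f y)}"

lemma additive_bijectionsD:
  assumes "f \<in> additive_bijections"
  shows "bij f" "f (x + y) = f x + f y" "f x = f y \<longleftrightarrow> x = y" "f 0 = 0"
proof -
  show "bij f" "f (x + y) = f x + f y" for x y
    using assms by (auto simp: additive_bijections_def)
  then show "f x = f y \<longleftrightarrow> x = y"
    by (metis bij_pointE)
  have "f (0 + 0) = f 0 + f 0"
    using assms by (auto simp only: additive_bijections_def)
  then show "f 0 = 0" by simp
qed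

text \<open>In exponent two these are the ordered pairs that generate a zero-sum triple
  \<open>{x, y, x + y}\<close> of distinct non-zero elements.\<close>

definition distinct_nonzero_pairs :: "('a::zero \<times> 'a) set" where
  "distinct_nonzero_pairs = {(x, y). x \<noteq> 0 \<and> y \<noteq> 0 \<and> x \<noteq> y}"

lemma card_distinct_nonzero_pairs:
  "int (card (distinct_nonzero_pairs :: ('a::{zero,finite} \<times> 'a) set)) =
    (int CARD('a) - 1) * (int CARD('a) - 2)"
proof -
  have Sigma: "distinct_nonzero_pairs = (SIGMA x:UNIV - {0::'a}. UNIV - {0, x})"
    by (auto simp: distinct_nonzero_pairs_def)
  have "card (distinct_nonzero_pairs :: ('a \<times> 'a) set) =
      (\<Sum>x\<in>UNIV - {0::'a}. card (UNIV - {0, x}))"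
    unfolding Sigma by (rule card_SigmaI) auto
  also have "\<dots> = (\<Sum>x\<in>UNIV - {0::'a}. CARD('a) - 2)"
    by (intro sum.cong) (auto simp: card_Diff_subset)
  also have "\<dots> = (CARD('a) - 1) * (CARD('a) - 2)"
    by (simp add: card_Diff_singleton)
  finally have "card (distinct_nonzero_pairs :: ('a \<times> 'a) set) = (CARD('a) - 1) * (CARD('a) - 2)" .
  moreover have "CARD('a) \<noteq> 0" by simp
  then have "CARD('a) = 1 \<or> CARD('a) \<ge> 2" by linarith
  ultimately show ?thesis
    by (auto simp: of_nat_diff)
qed

text \<open>A random automorphism sends a fixed pair to a uniformly distributed one. By transitivity
  the left sum is the same for all pairs; adding over all pairs and swapping the sums, each
  automorphism merely permutes the pairs.\<close>

lemma sum_additive_bijections_pair: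
  fixes P :: "'a::{ab_group_add,finite} \<Rightarrow> 'a \<Rightarrow> int"
  assumes trans: "\<And>u v u' v' :: 'a. (u, v) \<in> distinct_nonzero_pairs \<Longrightarrow>
      (u', v') \<in> distinct_nonzero_pairs \<Longrightarrow> \<exists>f\<in>additive_bijections. f u = u' \<and> f v = v'"
    and uv: "(u, v) \<in> distinct_nonzero_pairs"
  shows "int (card (distinct_nonzero_pairs :: ('a \<times> 'a) set)) * (\<Sum>f\<in>additive_bijections. P (f u) (f v)) =
    int (card (additive_bijections :: ('a \<Rightarrow> 'a) set)) * (\<Sum>(x, y)\<in>distinct_nonzero_pairs. P x y)"
proof -
  let ?G = "additive_bijections :: ('a \<Rightarrow> 'a) set"
  let ?D = "distinct_nonzero_pairs :: ('a \<times> 'a) set"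
  \<comment> \<open>Composition on the right with an automorphism that carries \<open>(u, v)\<close>
    to \<open>(u', v')\<close> re-indexes the sum.\<close>
  have indep: "(\<Sum>f\<in>?G. P (f u') (f v')) = (\<Sum>f\<in>?G. P (f u) (f v))" if uv': "(u', v') \<in> ?D" for u' v'
  proof -
    obtain h where h: "h \<in> ?G" "h u = u'" "h v = v'"
      using trans[OF uv uv'] by blast
    have bh: "bij h" using h(1) by (rule additive_bijectionsD)
    have add_inv: "inv h (x + y) = inv h x + inv h y" for x y
      using bh additive_bijectionsD(2)[OF h(1)] by (metis bij_inv_eq_iff)
    have "bij_betw (\<lambda>f. f \<circ> h) ?G ?G"
    proof (rule bij_betwI[where g = "\<lambda>f. f \<circ> inv h"])
      show "(\<lambda>f. f \<circ> h) \<in> ?G \<rightarrow> ?G"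
        using h(1) by (auto simp: additive_bijections_def intro: bij_comp)
      show "(\<lambda>f. f \<circ> inv h) \<in> ?G \<rightarrow> ?G"
        using bh add_inv by (auto simp: additive_bijections_def intro: bij_comp bij_imp_bij_inv)
    qed (use bh in \<open>auto simp: fun_eq_iff bij_is_inj bij_is_surj surj_f_inv_f\<close>)
    then have "(\<Sum>f\<in>?G. P ((f \<circ> h) u) ((f \<circ> h) v)) = (\<Sum>f\<in>?G. P (f u) (f v))"
      by (rule sum.reindex_bij_betw)
    then show ?thesis using h by simp
  qed
  have perm: "(\<Sum>(x, y)\<in>?D. P (f x) (f y)) = (\<Sum>(x, y)\<in>?D. P x y)" if f: "f \<in> ?G" for f
  proof -
    have "bij_betw (map_prod f f) ?D ?D"
    proof (rule bij_betwI[where g = "map_prod (inv f) (inv f)"])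
      show "map_prod f f \<in> ?D \<rightarrow> ?D"
        using additive_bijectionsD(3,4)[OF f]
        by (auto simp: distinct_nonzero_pairs_def) metis+
      show "map_prod (inv f) (inv f) \<in> ?D \<rightarrow> ?D"
        using additive_bijectionsD(1,4)[OF f]
        by (auto simp: distinct_nonzero_pairs_def bij_inv_eq_iff bij_is_surj inj_imp_inv_eq dest: bij_betw_inv_into)
          (metis bij_inv_eq_iff)+
    qed (use additive_bijectionsD(1)[OF f] in \<open>auto simp: bij_is_inj bij_is_surj surj_f_inv_f\<close>)
    then have "(\<Sum>p\<in>?D. case map_prod f f p of (x, y) \<Rightarrow> P x y) = (\<Sum>(x, y)\<in>?D. P x y)"
      by (rule sum.reindex_bij_betw)
    then show ?thesis by (simp add: case_prod_unfold)
  qed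
  have "int (card ?D) * (\<Sum>f\<in>?G. P (f u) (f v)) = (\<Sum>(u', v')\<in>?D. \<Sum>f\<in>?G. P (f u') (f v'))"
    using indep by (simp add: case_prod_unfold)
  also have "\<dots> = (\<Sum>f\<in>?G. \<Sum>(x, y)\<in>?D. P (f x) (f y))"
    unfolding case_prod_unfold by (rule sum.swap)
  also have "\<dots> = int (card ?G) * (\<Sum>(x, y)\<in>?D. P x y)"
    using perm by simp
  finally show ?thesis .
qed

text \<open>Some automorphism sends at least the average number of triples of the family into
  \<open>A\<close>; \<open>U\<close> is the union of these images.\<close>

lemma triples_packing_by_averaging:
  fixes A X :: "'a::{ab_group_add,finite} set" and \<psi> :: "'a \<Rightarrow> 'a"
  assumes two: "\<And>x::'a. x + x = 0" and A0: "0 \<notin> A"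
    and trans: "\<And>u v u' v' :: 'a. (u, v) \<in> distinct_nonzero_pairs \<Longrightarrow>
      (u', v') \<in> distinct_nonzero_pairs \<Longrightarrow> \<exists>f\<in>additive_bijections. f u = u' \<and> f v = v'"
    and X: "\<And>x. x \<in> X \<Longrightarrow> (x, \<psi> x) \<in> distinct_nonzero_pairs"
    and disj: "disjoint_family_on (\<lambda>x. {x, \<psi> x, x + \<psi> x}) X"
  shows "\<exists>U t. U \<subseteq> A \<and> card U = 3 * t \<and> zs_packing (\<lambda>x. x) U t \<and>
    int (card X) * (int (card A) * (2 * int (card A) - int CARD('a)))
      \<le> int t * ((int CARD('a) - 1) * (int CARD('a) - 2))"
proof -
  let ?G = "additive_bijections :: ('a \<Rightarrow> 'a) set"
  let ?D = "distinct_nonzero_pairs :: ('a \<times> 'a) set"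
  define P where "P x y = (if x \<in> A \<and> y \<in> A \<and> x + y \<in> A then 1 else 0 :: int)" for x y
  define c where "c f = (\<Sum>x\<in>X. P (f x) (f (\<psi> x)))" for f
  define L where "L = int (card A) * (2 * int (card A) - int CARD('a))"
  have "(\<Sum>(x, y)\<in>?D. P x y) = int (card {(x, y). x \<in> A \<and> y \<in> A \<and> x \<noteq> y \<and> x + y \<in> A})"
  proof -
    have "?D \<inter> {p. fst p \<in> A \<and> snd p \<in> A \<and> fst p + snd p \<in> A} =
        {(x, y). x \<in> A \<and> y \<in> A \<and> x \<noteq> y \<and> x + y \<in> A}"
      using A0 by (auto simp: distinct_nonzero_pairs_def)
    then show ?thesis
      by (simp add: P_def case_prod_unfold sum.If_cases)
  qed
  then have L: "L \<le> (\<Sum>(x, y)\<in>?D. P x y)"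
    using card_triples_in_set[OF two A0] by (simp add: L_def)
  have "int (card ?D) * (\<Sum>f\<in>?G. c f) = (\<Sum>x\<in>X. int (card ?D) * (\<Sum>f\<in>?G. P (f x) (f (\<psi> x))))"
    unfolding c_def by (subst sum.swap) (simp add: sum_distrib_left)
  also have "\<dots> = (\<Sum>x\<in>X. int (card ?G) * (\<Sum>(x, y)\<in>?D. P x y))"
    using X by (intro sum.cong refl sum_additive_bijections_pair trans) auto
  also have "\<dots> \<ge> (\<Sum>x\<in>X. int (card ?G) * L)"
    by (intro sum_mono mult_left_mono L) auto
  finally have "(\<Sum>x\<in>X. int (card ?G) * L) \<le> int (card ?D) * (\<Sum>f\<in>?G. c f)" .
  then have total: "(\<Sum>f\<in>?G. int (card X) * L) \<le> (\<Sum>f\<in>?G. int (card ?D) * c f)"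
    by (simp only: sum_distrib_left[symmetric] sum_constant) (simp add: mult_ac)
  \<comment> \<open>The strict comparison of sums below requires a non-empty index set.\<close>
  have idG: "id \<in> ?G" by (simp add: additive_bijections_def)
  have "\<exists>f\<in>?G. int (card X) * L \<le> int (card ?D) * c f"
  proof (rule ccontr)
    assume "\<not> ?thesis"
    then have "(\<Sum>f\<in>?G. int (card ?D) * c f) < (\<Sum>f\<in>?G. int (card X) * L)"
      using idG by (intro sum_strict_mono) auto
    with total show False by linarith
  qed
  then obtain f where f: "f \<in> ?G" "int (card X) * L \<le> int (card ?D) * c f" by blast
  note fD = additive_bijectionsD[OF f(1)]
  define T where "T x = {f x, f (\<psi> x), f x + f (\<psi> x)}" for x
  define Y where "Y = {x \<in> X. T x \<subseteq> A}"
  have cY: "c f = int (card Y)"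
  proof -
    have "X \<inter> {x. f x \<in> A \<and> f (\<psi> x) \<in> A \<and> f x + f (\<psi> x) \<in> A} = Y"
      by (auto simp: Y_def T_def)
    then show ?thesis by (simp add: c_def P_def sum.If_cases)
  qed
  have T_img: "T x = f ` {x, \<psi> x, x + \<psi> x}" for x
    using fD(2) by (simp add: T_def)
  have dT: "T x \<inter> T y = {}" if "x \<in> X" "y \<in> X" "x \<noteq> y" for x y
  proof -
    have "{x, \<psi> x, x + \<psi> x} \<inter> {y, \<psi> y, y + \<psi> y} = {}"
      using disj that unfolding disjoint_family_on_def by blast
    then show ?thesis
      unfolding T_img using fD(1) by (metis bij_is_inj image_Int image_empty)
  qed
  have card_T: "card (T x) = 3" and sum_T: "\<Sum>(T x) = 0" if "x \<in> X" for x
  proof -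
    have d: "(x, \<psi> x) \<in> ?D" using X that by simp
    have "f x \<noteq> 0" "f (\<psi> x) \<noteq> 0" "f x \<noteq> f (\<psi> x)"
      using d fD(3,4) unfolding distinct_nonzero_pairs_def by (auto, metis+)
    then have "f x \<noteq> f (\<psi> x)" "f x \<noteq> f x + f (\<psi> x)" "f (\<psi> x) \<noteq> f x + f (\<psi> x)"
      by auto
    then show "card (T x) = 3" "\<Sum>(T x) = 0"
      using two[of "f x + f (\<psi> x)"] by (simp_all add: T_def add.assoc)
  qed
  have YX: "Y \<subseteq> X" by (auto simp: Y_def)
  have injT: "inj_on T Y"
  proof (rule inj_onI, rule ccontr)
    fix x y assume "x \<in> Y" "y \<in> Y" "T x = T y" "x \<noteq> y"
    then have "T x = {}" using dT YX by (metis inf.idem subsetD)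
    then show False by (simp add: T_def)
  qed
  define U where "U = (\<Union>x\<in>Y. T x)"
  have "card U = (\<Sum>x\<in>Y. card (T x))"
    unfolding U_def using dT YX by (intro card_UN_disjoint) (auto simp: T_def)
  then have cU: "card U = 3 * card Y"
    using card_T YX by (simp add: subset_iff)
  have "zs_packing (\<lambda>x. x) U (card Y)"
    unfolding zs_packing_def
  proof (intro exI[of _ "T ` Y"] conjI ballI)
    show "disjoint (T ` Y)"
      unfolding disjoint_def using dT YX by (metis (no_types, lifting) imageE subsetD)
    show "card (T ` Y) = card Y" using injT by (rule card_image)
    fix B assume "B \<in> T ` Y"
    then obtain x where x: "x \<in> Y" "B = T x" by blast
    then show "B \<noteq> {}" "B \<subseteq> U" "\<Sum>B = 0"
      using sum_T YX by (auto simp: U_def T_def)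
  qed simp
  moreover have "U \<subseteq> A" by (auto simp: U_def Y_def)
  ultimately show ?thesis
    using cU f(2) unfolding cY L_def card_distinct_nonzero_pairs
    by (intro exI[of _ U] exI[of _ "card Y"]) (simp add: mult_ac)
qed

section \<open>A near-partition into zero-sum triples\<close>

text \<open>Over \<open>F\<^sub>2\<close> we have \<open>x\<^sup>5 + x\<^sup>4 + 1 = (x\<^sup>2 + x + 1) (x\<^sup>3 + x + 1)\<close>. So \<open>\<psi>\<^sup>3 + \<psi> + 1\<close> maps onto a space
  on which \<open>\<psi>\<close> permutes the non-zero elements in zero-sum orbits \<open>{a, \<psi> a, a + \<psi> a}\<close>. Choosing one
  representative of each orbit and pulling it back gives the triples.\<close>

lemma triple_partition:
  fixes \<psi> :: "'a::{ab_group_add,finite} \<Rightarrow> 'a"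
  assumes two: "\<And>x::'a. x + x = 0"
    and add: "\<And>x y. \<psi> (x + y) = \<psi> x + \<psi> y"
    and poly: "\<And>x. \<psi> (\<psi> (\<psi> (\<psi> (\<psi> x)))) + \<psi> (\<psi> (\<psi> (\<psi> x))) + x = 0"
  shows "\<exists>X. (\<forall>x\<in>X. (x, \<psi> x) \<in> distinct_nonzero_pairs) \<and>
    disjoint_family_on (\<lambda>x. {x, \<psi> x, x + \<psi> x}) X \<and>
    CARD('a) \<le> 3 * card X + card {x. \<psi> (\<psi> (\<psi> x)) + \<psi> x + x = 0}"
proof -
  note add0 = add_eq_0_iff_eq_of_exponent_two[OF two]
  have cancel: "x + (x + y) = y" for x y :: 'a
    by (metis add.assoc add.left_neutral two)
  define \<theta> where "\<theta> x = x + \<psi> x" for x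
  define p where "p x = \<psi> (\<psi> (\<psi> x)) + \<psi> x + x" for x
  have zero: "\<psi> 0 = 0"
    using add[of 0 0] by simp
  \<comment> \<open>\<open>poly\<close> says that four applications of \<open>\<psi>\<close> invert
    \<open>\<theta>\<close>; hence \<open>\<theta>\<close> and \<open>\<psi>\<close> are both
    injective.\<close>
  have recover: "\<psi> (\<psi> (\<psi> (\<psi> (\<theta> x)))) = x" for x
    using poly[of x] unfolding \<theta>_def add add0 by (simp add: add_ac)
  have inj\<theta>: "inj \<theta>"
    by (rule inj_on_inverseI[where g = "\<lambda>x. \<psi> (\<psi> (\<psi> (\<psi> x)))"]) (rule recover)
  have inj\<psi>: "inj \<psi>"
    by (rule inj_on_inverseI[where g = "\<lambda>x. \<psi> (\<psi> (\<psi> (\<theta> x)))"])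
      (use recover in \<open>simp add: \<theta>_def add\<close>)
  have p\<psi>: "p (\<psi> x) = \<psi> (p x)" and p\<theta>: "p (\<theta> x) = \<theta> (p x)" for x
    by (simp_all add: p_def \<theta>_def add add_ac)
  have quad: "\<psi> (\<psi> (p x)) = \<theta> (p x)" for x
  proof -
    have "\<psi> (\<psi> (p x)) + \<theta> (p x) = \<psi> (\<psi> (\<psi> (\<psi> (\<psi> x)))) + \<psi> (\<psi> (\<psi> (\<psi> x))) + x"
      by (simp add: p_def \<theta>_def add add_ac cancel)
    then show ?thesis
      using poly add0 by metis
  qed
  define O' where "O' a = {a, \<psi> a, \<theta> a}" for a
  \<comment> \<open>Under this hypothesis \<open>\<psi>\<close> has cube 1 on \<open>a\<close>, so
    the triple is a cycle of \<open>\<psi>\<close> that each member generates.\<close>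
  have orbit: "O' b = O' a" if "\<psi> (\<psi> a) = \<theta> a" "b \<in> O' a" for a b
  proof -
    have "\<theta> (\<psi> a) = a" "\<psi> (\<theta> a) = a" "\<theta> (\<theta> a) = \<psi> a"
      using that(1) by (simp_all add: \<theta>_def add add_ac cancel two)
    then show ?thesis
      using that by (auto simp: O'_def)
  qed
  have p_orbit: "O' (p y) = O' (p x)" if "y \<in> O' x" for x y
    using that by (intro orbit quad) (auto simp: O'_def p\<psi> p\<theta>)
  \<comment> \<open>The choice depends only on the orbit as a set, so its members share one
    representative.\<close>
  define rep :: "'a set \<Rightarrow> 'a" where "rep S = (SOME y. y \<in> S)" for S
  have rep_in: "rep (O' a) \<in> O' a" for a
    unfolding rep_def by (rule someI[of _ a]) (simp add: O'_def)
  define X where "X = {x. p x \<noteq> 0 \<and> rep (O' (p x)) = p x}"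
  have nz: "\<psi> x \<noteq> 0" "\<theta> x \<noteq> 0" if "x \<noteq> 0" for x
  proof -
    show "\<psi> x \<noteq> 0" using that inj\<psi> zero by (metis injD)
    have "\<theta> 0 = 0" by (simp add: \<theta>_def zero)
    then show "\<theta> x \<noteq> 0" using that inj\<theta> by (metis injD)
  qed
  have distinct: "a \<noteq> \<psi> a" "a \<noteq> \<theta> a" "\<psi> a \<noteq> \<theta> a" if "a \<noteq> 0" for a
    using nz[OF that] that by (auto simp: \<theta>_def two)
  have Xnz: "x \<noteq> 0" if "x \<in> X" for x
    using that by (auto simp: X_def p_def zero)
  have "(x, \<psi> x) \<in> distinct_nonzero_pairs" if "x \<in> X" for x
    using Xnz[OF that] nz(1) distinct(1) by (simp add: distinct_nonzero_pairs_def)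
  moreover have "O' x \<inter> O' x' = {}" if x: "x \<in> X" "x' \<in> X" "x \<noteq> x'" for x x'
  proof (rule ccontr)
    assume "O' x \<inter> O' x' \<noteq> {}"
    then obtain y where y: "y \<in> O' x" "y \<in> O' x'" by blast
    then have "O' (p x) = O' (p x')"
      using p_orbit by metis
    then have same: "p x = p x'" "p x \<noteq> 0"
      using x by (auto simp: X_def)
    \<comment> \<open>The three members of the orbit of \<open>p x\<close> differ, so
      \<open>p y\<close> reveals the position of \<open>y\<close>, which is then the same in both
      triples.\<close>
    have "y = x \<and> p y = p x \<or> y = \<psi> x \<and> p y = \<psi> (p x) \<or> y = \<theta> x \<and> p y = \<theta> (p x)"
      using y(1) by (auto simp: O'_def p\<psi> p\<theta>)
    moreover have "y = x' \<and> p y = p x \<or> y = \<psi> x' \<and> p y = \<psi> (p x) \<or> y = \<theta> x' \<and> p y = \<theta> (p x)"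
      using y(2) same by (auto simp: O'_def p\<psi> p\<theta>)
    ultimately have "x = x' \<or> \<psi> x = \<psi> x' \<or> \<theta> x = \<theta> x'"
      using distinct[OF same(2)] by metis
    then show False
      using x(3) inj\<psi> inj\<theta> by (metis injD)
  qed
  then have "disjoint_family_on (\<lambda>x. {x, \<psi> x, x + \<psi> x}) X"
    by (simp add: disjoint_family_on_def O'_def \<theta>_def)
  moreover have "CARD('a) \<le> 3 * card X + card {x. p x = 0}"
  proof -
    \<comment> \<open>If \<open>p y\<close> is non-zero, it is \<open>a\<close>,
      \<open>\<psi> a\<close> or \<open>\<theta> a\<close> for the representative \<open>a\<close>
      of its orbit. Accordingly \<open>y\<close>, its \<open>\<psi>\<close>-preimage
      \<open>z\<close> or its \<open>\<theta>\<close>-preimage \<open>w\<close> lies in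
      \<open>X\<close>.\<close>
    have "y \<in> (\<Union>x\<in>X. O' x) \<union> {x. p x = 0}" for y
    proof (cases "p y = 0")
      case False
      define a where "a = rep (O' (p y))"
      have "a \<in> O' (p y)" unfolding a_def by (rule rep_in)
      then have Oa: "O' a = O' (p y)" by (intro orbit quad)
      then have "p y \<in> O' a" by (simp add: O'_def)
      moreover have X: "x \<in> X" if "p x = a" for x
      proof -
        have "rep (O' a) = a"
          using Oa by (simp add: a_def)
        moreover have "a \<noteq> 0"
          using \<open>p y \<in> O' a\<close> False by (auto simp: O'_def \<theta>_def zero)
        ultimately show ?thesis using that by (simp add: X_def)
      qed
      moreover obtain z where z: "\<psi> z = y"
        using finite_UNIV_inj_surj[OF _ inj\<psi>] by (metis finite surjD)
      moreover obtain w where w: "\<theta> w = y"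
        using finite_UNIV_inj_surj[OF _ inj\<theta>] by (metis finite surjD)
      ultimately have "p y = a \<or> \<psi> (p z) = \<psi> a \<or> \<theta> (p w) = \<theta> a"
        using p\<psi>[of z] p\<theta>[of w] by (auto simp: O'_def)
      then have "y \<in> X \<or> z \<in> X \<or> w \<in> X"
        using X inj\<psi> inj\<theta> by (metis injD)
      moreover have "y \<in> O' y" "y \<in> O' z" "y \<in> O' w"
        using z w by (simp_all add: O'_def)
      ultimately show ?thesis
        by blast
    qed simp
    then have "CARD('a) \<le> card ((\<Union>x\<in>X. O' x) \<union> {x. p x = 0})"
      by (intro card_mono) auto
    also have "\<dots> \<le> card (\<Union>x\<in>X. O' x) + card {x. p x = 0}"
      by (rule card_Un_le)
    also have "card (\<Union>x\<in>X. O' x) \<le> (\<Sum>x\<in>X. card (O' x))"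
      by (rule card_UN_le) simp
    also have "\<dots> \<le> (\<Sum>x\<in>X. 3)"
      by (intro sum_mono) (simp add: O'_def card_insert_if)
    finally show ?thesis by simp
  qed
  ultimately show ?thesis
    unfolding p_def by blast
qed

section \<open>The group \<open>C\<^sub>2\<^sup>r\<close>\<close>

lemma bit_vec_add_self: "x + x = (0 :: bit ^ 'n)"
  by (simp add: vec_eq_iff)

lemma card_bit: "CARD(bit) = 2"
proof -
  have "(UNIV :: bit set) = {0, 1}"
    using bit.exhaust by auto
  then show ?thesis
    by (metis card_2_iff zero_neq_one)
qed

text \<open>Over the field of two elements distinct non-zero vectors are linearly independent, so
  the assignment extends to an injective linear map, which is bijective by finiteness.\<close>

lemma additive_bijections_bit_vec_transitive:
  fixes u v u' v' :: "bit ^ 'n::finite"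
  assumes "(u, v) \<in> distinct_nonzero_pairs" "(u', v') \<in> distinct_nonzero_pairs"
  shows "\<exists>f\<in>additive_bijections. f u = u' \<and> f v = v'"
proof -
  have indep: "vec.independent {x, y}" if "(x, y) \<in> distinct_nonzero_pairs" for x y :: "bit ^ 'n"
  proof -
    have "x \<noteq> c *s y" for c
      using that by (cases c) (auto simp: distinct_nonzero_pairs_def)
    then show ?thesis
      using that by (auto simp: vec.independent_insert vec.span_singleton distinct_nonzero_pairs_def)
  qed
  define f where "f x = (if x = u then u' else v')" for x
  have img: "f ` {u, v} = {u', v'}" "inj_on f {u, v}"
    using assms by (auto simp: f_def inj_on_def distinct_nonzero_pairs_def)
  obtain g where g: "Vector_Spaces.linear (*s) (*s) g" "inj g" "\<forall>x\<in>{u, v}. g x = f x"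
    using vec.linear_independent_extend_inj[of "{u, v}" f] indep assms img by auto
  interpret g: Vector_Spaces.linear "(*s)" "(*s)" g by (rule g(1))
  have "bij g"
    using g(2) finite_UNIV_inj_surj by (metis bij_def finite)
  then have "g \<in> additive_bijections"
    by (simp add: additive_bijections_def g.add)
  moreover have "g u = u'" "g v = v'"
    using g(3) assms by (auto simp: f_def distinct_nonzero_pairs_def)
  ultimately show ?thesis by blast
qed

text \<open>The operator is a direct sum of \<open>2 \<times> 2\<close> blocks with characteristic polynomial \<open>x\<^sup>2 + x + 1\<close> and,
  for odd \<open>r\<close>, one \<open>3 \<times> 3\<close> block with characteristic polynomial \<open>x\<^sup>3 + x + 1\<close>.\<close>

lemma bit_vec_operator:
  assumes "CARD('n::finite) \<ge> 2"
  shows "\<exists>\<psi> :: bit ^ 'n \<Rightarrow> bit ^ 'n. (\<forall>x y. \<psi> (x + y) = \<psi> x + \<psi> y) \<and>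
    (\<forall>x. \<psi> (\<psi> (\<psi> (\<psi> (\<psi> x)))) + \<psi> (\<psi> (\<psi> (\<psi> x))) + x = 0) \<and>
    card {x. \<psi> (\<psi> (\<psi> x)) + \<psi> x + x = 0} \<le> 8"
proof -
  define r where "r = CARD('n)"
  obtain e :: "'n \<Rightarrow> nat" where e: "bij_betw e UNIV {0..<r}"
    unfolding r_def using ex_bij_betw_finite_nat[of "UNIV :: 'n set"] by auto
  \<comment> \<open>The size of the cubic block: an odd \<open>r \<ge> 2\<close> has room for three
    coordinates, and the other \<open>r - h\<close> split into pairs.\<close>
  define h :: nat where "h = (if even r then 0 else 3)"
  have h: "h \<le> r" "even (r - h)" "h = 0 \<or> h = 3"
    using assms by (auto simp: h_def r_def elim!: oddE)
  define c :: "bit ^ 'n \<Rightarrow> nat \<Rightarrow> bit" where "c x k = x $ inv e k" for x k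
  have e_lt: "e i < r" for i
    using e by (auto simp: bij_betw_def)
  have inv_e: "e (inv e k) = k" if "k < r" for k
    using e that by (metis atLeastLessThan_iff bij_betw_imp_surj_on f_inv_into_f le0)
  have e_inv: "inv e (e i) = i" for i
    using e by (simp add: bij_betw_def)
  have ext: "x = y" if "\<And>k. k < r \<Longrightarrow> c x k = c y k" for x y
    using that e_lt by (metis c_def e_inv vec_eq_iff)
  have c_add: "c (x + y) k = c x k + c y k" and c_0: "c 0 k = 0" for x y k
    by (simp_all add: c_def)
  \<comment> \<open>Companion matrices: multiplication by x modulo x^3 + x + 1 on the first
    \<open>h\<close> coordinates and modulo x^2 + x + 1 on each later pair, coefficients in
    ascending order.\<close>
  define \<psi> :: "bit ^ 'n \<Rightarrow> bit ^ 'n" where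
    "\<psi> x = (\<chi> i. let k = e i in
       if k < h then (if k = 0 then c x 2 else if k = 1 then c x 0 + c x 2 else c x 1)
       else if even (k - h) then c x (k + 1) else c x (k - 1) + c x k)" for x
  have c_\<psi>: "c (\<psi> x) k =
      (if k < h then (if k = 0 then c x 2 else if k = 1 then c x 0 + c x 2 else c x 1)
       else if even (k - h) then c x (k + 1) else c x (k - 1) + c x k)" if "k < r" for x k
  proof -
    have "c (\<psi> x) k = \<psi> x $ inv e k"
      by (simp only: c_def)
    then show ?thesis
      by (simp only: \<psi>_def vec_lambda_beta inv_e[OF that] Let_def)
  qed
  have low: "c (\<psi> x) 0 = c x 2" "c (\<psi> x) (Suc 0) = c x 0 + c x 2" "c (\<psi> x) 2 = c x (Suc 0)" if "h = 3" for x
    using h(1) that by (simp_all add: c_\<psi>)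
  have high: "c (\<psi> x) k = c x (Suc k)" "c (\<psi> x) (Suc k) = c x k + c x (Suc k)"
    if "k \<ge> h" "even (k - h)" "Suc k < r" for x k
    using that by (simp_all add: c_\<psi> Suc_diff_le)
  have pair: "\<exists>j. j \<ge> h \<and> even (j - h) \<and> Suc j < r \<and> (k = j \<or> k = Suc j)" if "k \<ge> h" "k < r" for k
  proof (cases "even (k - h)")
    case True
    then have "Suc k \<noteq> r" using h(2) that by (auto simp: Suc_diff_le)
    then show ?thesis using True that by (intro exI[of _ k]) auto
  next
    case False
    then have "k \<noteq> h" by auto
    then have "k - 1 \<ge> h" "even (k - 1 - h)" "k = Suc (k - 1)"
      using False that by auto
    then show ?thesis using that by (intro exI[of _ "k - 1"]) auto
  qed
  have bit2: "b + b = 0" "b + (b + b') = b'" for b b' :: bit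
    by (cases b; cases b'; simp)+
  \<comment> \<open>A claim about all coordinates reduces to the cubic block and one generic
    pair.\<close>
  have coords: "P k" if "h = 3 \<Longrightarrow> P 0 \<and> P (Suc 0) \<and> P 2"
    "\<And>j. j \<ge> h \<Longrightarrow> even (j - h) \<Longrightarrow> Suc j < r \<Longrightarrow> P j \<and> P (Suc j)" "k < r" for P k
  proof (cases "k < h")
    case True
    then have "k = 0 \<or> k = Suc 0 \<or> k = 2" "h = 3" using h(3) by auto
    then show ?thesis using that(1) by auto
  next
    case False
    then show ?thesis using pair[of k] that by auto
  qed
  have "\<psi> (x + y) = \<psi> x + \<psi> y" for x y
    by (rule ext, rule coords) (auto simp: c_add low high add_ac)
  moreover have "\<psi> (\<psi> (\<psi> (\<psi> (\<psi> x)))) + \<psi> (\<psi> (\<psi> (\<psi> x))) + x = 0" for x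
    by (rule ext, rule coords) (auto simp: c_add c_0 low high add_ac bit2)
  moreover have "card {x. \<psi> (\<psi> (\<psi> x)) + \<psi> x + x = 0} \<le> 8"
  proof -
    let ?K = "{x. \<psi> (\<psi> (\<psi> x)) + \<psi> x + x = 0}"
    \<comment> \<open>On a pair \<open>\<psi>\<close> has cube 1, so there the kernel condition
      reads \<open>\<psi> x = 0\<close>, and \<open>\<psi>\<close> is injective. Only the cubic
      block can contribute, at most 8 vectors.\<close>
    have vanish: "c x k = 0" if x: "x \<in> ?K" and k: "k \<ge> h" "k < r" for x k
    proof -
      obtain j where j: "j \<ge> h" "even (j - h)" "Suc j < r" "k = j \<or> k = Suc j"
        using pair k by blast
      have "c (\<psi> (\<psi> (\<psi> x)) + \<psi> x + x) m = 0" for m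
        using x by (simp add: c_0)
      from this[of j] this[of "Suc j"] have "c x (Suc j) = 0" "c x j = 0"
        by (auto simp: c_add high[OF j(1-3)] add_ac bit2)
      then show ?thesis using j(4) by auto
    qed
    have "inj_on (\<lambda>x. (c x 0, c x (Suc 0), c x 2)) ?K"
    proof (rule inj_onI, rule ext, rule coords)
      fix x y j
      assume x: "x \<in> ?K" "y \<in> ?K" "(c x 0, c x (Suc 0), c x 2) = (c y 0, c y (Suc 0), c y 2)"
      then show "c x 0 = c y 0 \<and> c x (Suc 0) = c y (Suc 0) \<and> c x 2 = c y 2" by simp
      show "c x j = c y j \<and> c x (Suc j) = c y (Suc j)" if "h \<le> j" "Suc j < r"
        using vanish x that by simp
    qed
    then have "card ?K \<le> card (UNIV :: (bit \<times> bit \<times> bit) set)"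
      by (rule card_inj_on_le) auto
    also have "\<dots> = 8"
      by (simp add: card_bit card_cartesian_product flip: UNIV_Times_UNIV)
    finally show ?thesis .
  qed
  ultimately show ?thesis by blast
qed

section \<open>The bounds\<close>

lemma defect_of_punctured_group:
  fixes \<psi> :: "'a::{ab_group_add,finite} \<Rightarrow> 'a"
  assumes two: "\<And>x::'a. x + x = 0"
    and add: "\<And>x y. \<psi> (x + y) = \<psi> x + \<psi> y"
    and poly: "\<And>x. \<psi> (\<psi> (\<psi> (\<psi> (\<psi> x)))) + \<psi> (\<psi> (\<psi> (\<psi> x))) + x = 0"
    and card4: "CARD('a) \<ge> 4"
  shows "set_defect TYPE('a) (int CARD('a) - 2 - 2 * int ((CARD('a) - 3) div 3))"
proof -
  note add0 = add_eq_0_iff_eq_of_exponent_two[OF two]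
  have psi0: "\<psi> 0 = 0" using add[of 0 0] by simp
  have recover: "\<psi> (\<psi> (\<psi> (\<psi> (\<psi> x + x)))) = x" for x
    using poly[of x] by (simp add: add add0)
  have inj: "inj \<psi>"
    using poly add0 by (metis injI)
  obtain g :: 'a where g: "g \<noteq> 0"
  proof -
    have "(UNIV :: 'a set) \<noteq> {0}"
    proof
      assume "(UNIV :: 'a set) = {0}"
      then have "CARD('a) = card {0::'a}" by simp
      with card4 show False by simp
    qed
    then show ?thesis using that by blast
  qed
  \<comment> \<open>The total is fixed because \<open>\<psi>\<close> permutes the group, and by
    \<open>recover\<close> a fixed point of \<open>\<psi>\<close> is \<open>0\<close>.\<close>
  have "\<Sum>(UNIV :: 'a set) = 0"
  proof -
    have "bij \<psi>"
      using inj finite_UNIV_inj_surj by (metis bij_def finite)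
    then have "\<Sum>(UNIV :: 'a set) = (\<Sum>x\<in>UNIV. \<psi> x)"
      using sum.reindex_bij_betw[of \<psi> UNIV UNIV "\<lambda>x. x"] by simp
    also have "\<dots> = \<psi> (\<Sum>(UNIV :: 'a set))"
      using sum_comp_morphism[of \<psi> "\<lambda>x. x" UNIV] psi0 add by (simp add: comp_def)
    finally have "\<psi> (\<Sum>(UNIV :: 'a set)) + \<Sum>(UNIV :: 'a set) = 0"
      using two by simp
    then show ?thesis
      using recover psi0 by metis
  qed
  define A where "A = UNIV - {0, g}"
  have "\<Sum>A + \<Sum>{0, g} = 0"
    unfolding A_def using sum.subset_diff[of "{0, g}" UNIV "\<lambda>x::'a. x"] \<open>\<Sum>UNIV = 0\<close> by simp
  then have sumA: "\<Sum>A \<noteq> 0"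
    using g by auto
  have cardA: "card A = CARD('a) - 2"
    unfolding A_def using g by (simp add: card_Diff_subset)
  \<comment> \<open>With \<open>N = CARD('a)\<close>,
    \<open>3 * Suc k = 3 * (N div 3) \<ge> N - 2\<close>: already \<open>Suc k\<close> blocks of
    size three would exhaust \<open>A\<close>.\<close>
  define k where "k = (CARD('a) - 3) div 3"
  have "\<not> zs_packing (\<lambda>x. x) A (Suc k)"
  proof
    assume "zs_packing (\<lambda>x. x) A (Suc k)"
    then obtain C where C: "finite C" "card C = Suc k" "disjoint C"
      "\<forall>B\<in>C. B \<noteq> {} \<and> B \<subseteq> A \<and> \<Sum>B = 0"
      unfolding zs_packing_def by blast
    have three: "3 \<le> card B" if "B \<in> C" for B
    proof (rule ccontr)
      assume "\<not> 3 \<le> card B"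
      moreover have B: "B \<noteq> {}" "B \<subseteq> A" "\<Sum>B = 0" using C(4) that by auto
      then have "card B \<noteq> 0" by simp
      ultimately have "card B = 1 \<or> card B = 2" by linarith
      then show False
      proof
        assume "card B = 1"
        then obtain x where "B = {x}" by (auto simp: card_1_singleton_iff)
        then show False using B by (auto simp: A_def)
      next
        assume "card B = 2"
        then obtain x y where "B = {x, y}" "x \<noteq> y" by (auto simp: card_2_iff)
        then show False using B by (auto simp: add0)
      qed
    qed
    have "3 * Suc k = (\<Sum>B\<in>C. 3)" using C(2) by simp
    also have "\<dots> \<le> (\<Sum>B\<in>C. card B)" by (intro sum_mono three)
    also have "\<dots> = card (\<Union>C)"
      using C(3) by (intro card_Union_disjoint[symmetric]) (auto simp: disjoint_def pairwise_def disjnt_def)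
    finally have "card A \<le> card (\<Union>C)"
      using cardA card4 unfolding k_def by presburger
    moreover have "\<Union>C \<subseteq> A" using C(4) by blast
    ultimately have "\<Union>C = A"
      by (intro card_seteq) auto
    moreover have "\<Sum>(\<Union>C) = (\<Sum>B\<in>C. \<Sum>B)"
      using C(3) sum.Union_disjoint[of C "\<lambda>x::'a. x"] by (auto simp: disjoint_def comp_def)
    ultimately show False
      using sumA C(4) by simp
  qed
  moreover have "0 \<notin> A" by (simp add: A_def)
  ultimately show ?thesis
    unfolding set_defect_def using cardA card4
    by (intro exI[of _ A] exI[of _ k]) (simp add: k_def of_nat_diff)
qed

text \<open>Averaging gives \<open>t\<close> triples, the greedy step \<open>q\<close> more blocks
  and a rest of size \<open>s\<close>. The estimates for \<open>a - t\<close> and \<open>s\<close>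
  are added and halved; their constants \<open>7 / 3\<close> and \<open>- 1 / 3\<close> combine to
  1.\<close>

lemma set_defect_upper_bound:
  fixes \<psi> :: "'a::{ab_group_add,finite} \<Rightarrow> 'a"
  assumes two: "\<And>x::'a. x + x = 0"
    and add: "\<And>x y. \<psi> (x + y) = \<psi> x + \<psi> y"
    and poly: "\<And>x. \<psi> (\<psi> (\<psi> (\<psi> (\<psi> x)))) + \<psi> (\<psi> (\<psi> (\<psi> x))) + x = 0"
    and ker: "card {x. \<psi> (\<psi> (\<psi> x)) + \<psi> x + x = 0} \<le> 8"
    and trans: "\<And>u v u' v' :: 'a. (u, v) \<in> distinct_nonzero_pairs \<Longrightarrow>
      (u', v') \<in> distinct_nonzero_pairs \<Longrightarrow> \<exists>f\<in>additive_bijections. f u = u' \<and> f v = v'"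
    and card4: "CARD('a) \<ge> 4"
    and d: "set_defect TYPE('a) d"
  shows "real_of_int d \<le> (real CARD('a) - 1) / 3 + 1 + sqrt (real CARD('a))"
proof -
  obtain A :: "'a set" and k where A: "0 \<notin> A" "\<not> zs_packing (\<lambda>x. x) A (Suc k)"
    "d = int (card A) - 2 * int k"
    using d unfolding set_defect_def by blast
  obtain X where X: "\<And>x. x \<in> X \<Longrightarrow> (x, \<psi> x) \<in> distinct_nonzero_pairs"
    "disjoint_family_on (\<lambda>x. {x, \<psi> x, x + \<psi> x}) X" "CARD('a) \<le> 3 * card X + 8"
    using triple_partition[of \<psi>, OF two add poly] ker by (meson add_left_mono le_trans)
  obtain U t where U: "U \<subseteq> A" "card U = 3 * t" "zs_packing (\<lambda>x. x) U t"
    "int (card X) * (int (card A) * (2 * int (card A) - int CARD('a)))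
      \<le> int t * ((int CARD('a) - 1) * (int CARD('a) - 2))"
    using triples_packing_by_averaging[OF two A(1) trans X(1,2)] by blast
  obtain q s where q: "zs_packing (\<lambda>x. x) (A - U) q" "card (A - U) \<le> 4 * q + s"
    "s * (s - 1) \<le> 2 * (CARD('a) - 1)"
    using greedy_zs_packing[OF two] by blast
  have "zs_packing (\<lambda>x. x) (U \<union> (A - U)) (t + q)"
    using U(3) q(1) by (intro zs_packing_Un) auto
  moreover have "U \<union> (A - U) = A" using U(1) by blast
  ultimately have "t + q \<le> k"
    using A(2) zs_packing_antimono by (metis not_less_eq_eq)
  moreover have "card A \<le> 3 * t + 4 * q + s"
    using q(2) U(1,2) by (simp add: card_Diff_subset)
  \<comment> \<open>Here \<open>2 * d = 2 * card A - 4 * k\<close>, and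
    \<open>4 * k \<ge> 4 * t + 4 * q \<ge> card A + t - s\<close>.\<close>
  ultimately have "2 * d \<le> int (card A) - int t + int s"
    unfolding A(3) by presburger
  then have "real_of_int (2 * d) \<le> real_of_int (int (card A) - int t + int s)"
    by (simp only: of_int_le_iff)
  then have d_le: "2 * real_of_int d \<le> real (card A) - real t + real s"
    by simp
  define N where "N = real CARD('a)"
  define a where "a = real (card A)"
  have N4: "N \<ge> 4" using card4 by (simp add: N_def)
  have "A \<subseteq> UNIV - {0}" using A(1) by blast
  then have "card A \<le> card (UNIV - {0::'a})" by (intro card_mono) auto
  then have "card A + 1 \<le> CARD('a)" using card4 by (simp add: card_Diff_singleton)
  \<comment> \<open>Integrality keeps \<open>a\<close> out of the open interval from
    \<open>N - 2\<close> to \<open>N - 1\<close>, where the product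
    \<open>(N - 1 - a) * (N - 2 - a)\<close> used below is negative.\<close>
  then have "card A + 1 = CARD('a) \<or> card A + 2 \<le> CARD('a)"
    by linarith
  then have "real (card A + 1) = N \<or> real (card A + 2) \<le> N"
    unfolding N_def of_nat_eq_iff of_nat_le_iff .
  then have aN: "a + 1 = N \<or> a + 2 \<le> N" "a \<ge> 0"
    by (simp_all add: a_def add.commute)
  have "a - real t \<le> 2 * (N - 1) / 3 + 7 / 3"
  proof (cases "2 * a < N")
    case True
    then show ?thesis
      using N4 of_nat_0_le_iff[of t, where 'a = real] by (simp add: field_simps)
  next
    case False
    \<comment> \<open>The averaging bound reads \<open>(N - 8) / 3 * Q \<le> t * (N - 1)\<close>.
      Since \<open>N - 8 = (N - 1) - 7\<close> and \<open>Q \<le> N - 1\<close>, the uncovered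
      elements cost at most \<open>7 / 3\<close>.\<close>
    define Q where "Q = a * (2 * a - N) / (N - 2)"
    have N2: "N - 2 > 0" using N4 by simp
    have nonneg: "0 \<le> a * (2 * a - N)" using False aN by simp
    have "a * (2 * a - N) \<le> (N - 1) * (N - 2)"
      using False aN N4 by (intro mult_mono) auto
    then have Q1: "Q \<le> N - 1"
      using N2 by (simp add: Q_def divide_le_eq)
    have "real_of_int (int (card X) * (int (card A) * (2 * int (card A) - int CARD('a))))
      \<le> real_of_int (int t * ((int CARD('a) - 1) * (int CARD('a) - 2)))"
      using U(4) by (simp only: of_int_le_iff)
    then have "real (card X) * (a * (2 * a - N)) \<le> real t * ((N - 1) * (N - 2))"
      by (simp add: a_def N_def)
    moreover have "N \<le> real (3 * card X + 8)"
      using X(3) unfolding N_def of_nat_le_iff .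
    then have "(N - 8) / 3 \<le> real (card X)"
      by simp
    then have "(N - 8) / 3 * (a * (2 * a - N)) \<le> real (card X) * (a * (2 * a - N))"
      using nonneg by (intro mult_right_mono)
    ultimately have "(N - 8) / 3 * (a * (2 * a - N)) \<le> real t * ((N - 1) * (N - 2))"
      by linarith
    then have "(N - 8) / 3 * (a * (2 * a - N)) / (N - 2) \<le> real t * ((N - 1) * (N - 2)) / (N - 2)"
      using N2 by (intro divide_right_mono) auto
    then have "(N - 8) / 3 * Q \<le> real t * (N - 1)"
      using N2 by (simp add: Q_def)
    then have "(N - 1) * (Q / 3 - 7 / 3) \<le> (N - 1) * real t"
      using Q1 by (simp add: field_simps)
    then have t: "Q / 3 - 7 / 3 \<le> real t"
      using N4 by simp
    \<comment> \<open>Twice this product is the slack in \<open>3 * a - Q \<le> 2 * (N - 1)\<close>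
      multiplied by \<open>N - 2\<close>.\<close>
    have "0 \<le> (N - 1 - a) * (N - 2 - a)"
      using aN by auto
    then have "a * (3 * (N - 2)) - a * (2 * a - N) \<le> 2 * (N - 1) * (N - 2)"
      by (simp add: algebra_simps)
    moreover have "a * (2 * a - N) = Q * (N - 2)"
      using N2 by (simp add: Q_def)
    ultimately have "(3 * a - Q) * (N - 2) \<le> 2 * (N - 1) * (N - 2)"
      by (simp add: algebra_simps)
    then have "3 * a - Q \<le> 2 * (N - 1)"
      using N2 by (rule mult_right_le_imp_le)
    then show ?thesis
      using t by (simp add: field_simps)
  qed
  \<comment> \<open>The Sidon bound is of order \<open>sqrt (2 * N)\<close>, so
    \<open>2 * sqrt N\<close> leaves room to subtract the \<open>1 / 3\<close> that offsets part of
    \<open>7 / 3\<close>.\<close>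
  moreover have "real s \<le> 2 * sqrt N - 1 / 3"
  proof (rule ccontr)
    define w where "w = sqrt N"
    assume "\<not> real s \<le> 2 * sqrt N - 1 / 3"
    then have s: "2 * w - 1 / 3 < real s" by (simp add: w_def)
    have w2: "w * w = N" using N4 by (simp add: w_def)
    have w: "w \<ge> 2" unfolding w_def using N4 by (simp add: real_le_rsqrt)
    have "(2 * w - 1 / 3) * (2 * w - 4 / 3) \<le> real s * (real s - 1)"
      using s w by (intro mult_mono) auto
    also have "\<dots> = real (s * (s - 1))"
      by (cases s) (auto simp: algebra_simps)
    also have "\<dots> \<le> real (2 * (CARD('a) - 1))"
      using q(3) by (simp only: of_nat_le_iff)
    also have "\<dots> = 2 * (w * w) - 2"
      using card4 w2 by (simp add: N_def of_nat_diff)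
    finally have "2 * (w * w) - 10 / 3 * w + 22 / 9 \<le> 0"
      by (simp add: algebra_simps)
    \<comment> \<open>Completing the square: the quadratic exceeds this by
      \<open>22 / 9 - 25 / 18 > 0\<close>.\<close>
    moreover have "0 \<le> 2 * ((w - 5 / 6) * (w - 5 / 6))" by simp
    ultimately show False by (simp add: algebra_simps)
  qed
  ultimately show ?thesis
    using d_le unfolding a_def N_def by (simp add: field_simps)
qed

theorem theorem7p14:
  fixes r :: nat
  assumes "CARD('n::finite) = r" and "r \<ge> 2"
  shows "real_of_int \<lceil>(2 ^ r - 1) / (3::real)\<rceil> \<le> real (D0 TYPE(bit ^ 'n))
       \<and> real (D0 TYPE(bit ^ 'n)) \<le> real_of_int \<lceil>(2 ^ r - 1) / (3::real)\<rceil> + 2 powr (real r / 2)"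
proof -
  have two: "x + x = 0" for x :: "bit ^ 'n" by (rule bit_vec_add_self)
  have card: "CARD(bit ^ 'n) = 2 ^ r"
    using assms(1) by (simp add: card_bit)
  have "(2::nat) ^ 2 \<le> 2 ^ r"
    using assms(2) by (intro power_increasing) auto
  then have card4: "CARD(bit ^ 'n) \<ge> 4"
    unfolding card by simp
  obtain \<psi> :: "bit ^ 'n \<Rightarrow> bit ^ 'n" where \<psi>: "\<And>x y. \<psi> (x + y) = \<psi> x + \<psi> y"
    "\<And>x. \<psi> (\<psi> (\<psi> (\<psi> (\<psi> x)))) + \<psi> (\<psi> (\<psi> (\<psi> x))) + x = 0"
    "card {x. \<psi> (\<psi> (\<psi> x)) + \<psi> x + x = 0} \<le> 8"
    using bit_vec_operator[where 'n = 'n] assms by blast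
  have "(\<chi> i. 1) \<noteq> (0 :: bit ^ 'n)"
    by (simp add: vec_eq_iff)
  then obtain d where d: "set_defect TYPE(bit ^ 'n) d"
    "\<And>d'. set_defect TYPE(bit ^ 'n) d' \<Longrightarrow> d' \<le> d" "int (D0 TYPE(bit ^ 'n)) = d - 1"
    using D0_eq_max_defect[OF two] by metis
  have "\<lceil>(2 ^ r - 1) / (3::real)\<rceil> \<le> d - 1"
  proof -
    define m :: nat where "m = 2 ^ r"
    \<comment> \<open>The punctured group reaches the bound when \<open>m\<close> leaves remainder 1
      or 2 modulo 3; for a multiple of 3 this estimate would fall short.\<close>
    have "\<not> 3 dvd m"
      unfolding m_def using prime_dvd_power[of "3::nat" 2 r] by auto
    moreover have "m \<ge> 4"
      using card4 by (simp only: m_def card)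
    ultimately have "\<exists>j. m = 3 * Suc j + 1 \<or> m = 3 * Suc j + 2"
      by presburger
    then obtain j where j: "m = 3 * Suc j + 1 \<or> m = 3 * Suc j + 2"
      by blast
    then have "(m - 3) div 3 = j"
      by auto
    moreover have "int m - 2 - 2 * int ((m - 3) div 3) \<le> d"
      using d(2)[OF defect_of_punctured_group[OF two \<psi>(1,2) card4]] unfolding card m_def .
    ultimately have "int m - 1 \<le> 3 * (d - 1)"
      using j by auto
    then have "int (2 ^ r) - 1 \<le> 3 * (d - 1)"
      by (simp only: m_def)
    then have "real_of_int (int (2 ^ r) - 1) \<le> real_of_int (3 * (d - 1))"
      by (simp only: of_int_le_iff)
    then show ?thesis
      by (intro ceiling_le) (simp add: field_simps)
  qed
  \<comment> \<open>The \<open>+ 1\<close> in the bound for \<open>d\<close> cancels against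
    \<open>D0 = d - 1\<close>; rounding up at the end only weakens the estimate.\<close>
  moreover have "real_of_int d - 1 \<le> (2 ^ r - 1) / 3 + sqrt (2 ^ r)"
    using set_defect_upper_bound[OF two \<psi> additive_bijections_bit_vec_transitive card4 d(1)]
    unfolding card by simp
  moreover have "sqrt (2 ^ r) = 2 powr (real r / 2)"
    by (simp add: powr_half_sqrt[symmetric] powr_realpow[symmetric] powr_powr)
  moreover have "real (D0 TYPE(bit ^ 'n)) = real_of_int d - 1"
    using d(3) by linarith
  ultimately show ?thesis
    using le_of_int_ceiling[of "(2 ^ r - 1) / (3::real)"] by linarith
qed

end
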